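(* Let $X$ be a nonempty set. The monoid $\Gamma(X)$ is regular if and only if $\Gamma(X)=S(X)$.
   Context: $\Gamma(X)$ is the monoid, under composition, of all surjective maps $X\to X$, and $S(X)$ is the symmetric group of all bijections $X\to X$. A monoid $M$ is regular if for every $x\in M$ there is $y\in M$ with $xyx=x$. *)

theory Defs
  imports "HOL-Algebra.Bij"
begin

locale regular_monoid = monoid +
  assumes regular: "\<forall>x \<in> carrier G. \<exists>y \<in> carrier G. x \<otimes> y \<otimes> x = x"

text \<open>
  As for \<^const>\<open>Bij\<close>, a map \<open>X \<rightarrow> X\<close> is represented by its unique extension that is
  \<^const>\<open>undefined\<close> outside \<open>X\<close>, so that equality of representatives is equality of maps on \<open>X\<close>.
\<close>

definition Surj :: "'a set \<Rightarrow> ('a \<Rightarrow> 'a) set"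
  where "Surj X = extensional X \<inter> {f. f ` X = X}"

text \<open>
  The multiplication is restricted to the carrier in the same way as in \<^const>\<open>BijGroup\<close>, so
  that the symmetric group \<open>BijGroup X\<close> and \<open>SurjMonoid X\<close> can be compared as structures:
  they are equal as records if and only if their carriers are equal.
\<close>

definition SurjMonoid :: "'a set \<Rightarrow> ('a \<Rightarrow> 'a) monoid"
  where "SurjMonoid X =
    \<lparr>carrier = Surj X,
     mult = \<lambda>g \<in> Surj X. \<lambda>f \<in> Surj X. compose X g f,
     one = \<lambda>x \<in> X. x\<rparr>"

lemma compose_Surj: "compose X g f \<in> Surj X" if "g \<in> Surj X" "f \<in> Surj X"
  using that by (auto simp: Surj_def compose_def image_iff) (metis imageE image_eqI)+

lemma monoid_SurjMonoid: "monoid (SurjMonoid X)"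
proof (rule monoidI)
  fix f g h
  assume "f \<in> carrier (SurjMonoid X)" "g \<in> carrier (SurjMonoid X)" "h \<in> carrier (SurjMonoid X)"
  then show "f \<otimes>\<^bsub>SurjMonoid X\<^esub> g \<otimes>\<^bsub>SurjMonoid X\<^esub> h =
      f \<otimes>\<^bsub>SurjMonoid X\<^esub> (g \<otimes>\<^bsub>SurjMonoid X\<^esub> h)"
    by (auto simp: SurjMonoid_def compose_Surj) (auto simp: Surj_def compose_def fun_eq_iff)
qed (auto simp: SurjMonoid_def compose_Surj, auto simp: Surj_def compose_def fun_eq_iff extensional_def)

lemma SurjMonoid_eq_BijGroup_iff: "SurjMonoid X = BijGroup X \<longleftrightarrow> Surj X = Bij X"
  by (auto simp: SurjMonoid_def BijGroup_def)

end

theory Submission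
  imports Defs
begin

lemma Bij_subset_Surj: "Bij X \<subseteq> Surj X"
  by (auto simp: Bij_def Surj_def bij_betw_def)

text \<open>The inverse of \<open>x\<close> is a witness; this serves the converse direction,
  applied to the symmetric group.\<close>

lemma (in group) regular_monoid: "regular_monoid G"
proof unfold_locales
  show "\<forall>x \<in> carrier G. \<exists>y \<in> carrier G. x \<otimes> y \<otimes> x = x"
  proof
    fix x
    assume "x \<in> carrier G"
    then show "\<exists>y \<in> carrier G. x \<otimes> y \<otimes> x = x"
      by (intro bexI[of _ "inv x"]) simp_all
  qed
qed

text \<open>
  A surjection \<open>f\<close> can be cancelled on the right in \<open>f g f = f\<close>, so \<open>g\<close> is a section of \<open>f\<close>;
  as \<open>g\<close> is onto, \<open>f\<close> is injective.
\<close>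

lemma Surj_regular_imp_Bij:
  assumes f: "f \<in> Surj X" and g: "g \<in> Surj X"
    and fgf: "compose X (compose X f g) f = f"
  shows "f \<in> Bij X"
proof -
  have fX: "f ` X = X" and gX: "g ` X = X" and ext: "f \<in> extensional X"
    using f g by (auto simp: Surj_def)
  have section_g: "f (g c) = c" if "c \<in> X" for c
  proof -
    \<comment> \<open>Surjectivity of \<open>f\<close> writes \<open>c\<close> as
      \<open>f a\<close>, and \<open>fgf\<close> evaluated at \<open>a\<close> then reads
      \<open>f (g c) = c\<close>.\<close>
    from that have "c \<in> f ` X"
      by (simp only: fX)
    then obtain a where a: "a \<in> X" "c = f a"
      by (rule imageE)
    have "f (g (f a)) = compose X (compose X f g) f a"
      using a that by (simp add: compose_eq)
    also have "\<dots> = f a"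
      by (simp only: fgf)
    finally show ?thesis
      by (simp only: a(2))
  qed
  \<comment> \<open>If \<open>f\<close> agrees on \<open>g c\<close> and \<open>g d\<close>, then
    \<open>c = d\<close> by \<open>section_g\<close>, so the two points coincide.\<close>
  have "inj_on f (g ` X)"
    by (rule inj_onI) (auto simp: section_g)
  then have "inj_on f X"
    by (simp only: gX)
  with fX ext show ?thesis
    by (simp add: Bij_def bij_betw_def)
qed

theorem proposition3p10:
  fixes X :: "'a set"
  assumes "X \<noteq> {}"
  shows "regular_monoid (SurjMonoid X) \<longleftrightarrow> SurjMonoid X = BijGroup X"
proof
  assume "regular_monoid (SurjMonoid X)"
  then interpret regular_monoid "SurjMonoid X" .
  have "Surj X \<subseteq> Bij X"
  proof
    fix f
    assume f: "f \<in> Surj X"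
    then obtain g where g: "g \<in> Surj X"
      and fgf: "f \<otimes>\<^bsub>SurjMonoid X\<^esub> g \<otimes>\<^bsub>SurjMonoid X\<^esub> f = f"
      using regular by (auto simp: SurjMonoid_def)
    \<comment> \<open>Multiplication is restricted to \<open>Surj X\<close>, so unfolding the outer
      product needs \<open>compose_Surj\<close> for the inner one.\<close>
    have "compose X (compose X f g) f = f"
      using fgf f g by (simp add: SurjMonoid_def compose_Surj)
    with f g show "f \<in> Bij X"
      by (rule Surj_regular_imp_Bij)
  qed
  with Bij_subset_Surj show "SurjMonoid X = BijGroup X"
    unfolding SurjMonoid_eq_BijGroup_iff by blast
next
  assume "SurjMonoid X = BijGroup X"
  then show "regular_monoid (SurjMonoid X)"
    by (simp only: group.regular_monoid[OF group_BijGroup])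
qed

end
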